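(* Let $R$ be a commutative ring with unity and $Y\subseteq\mathrm{Spec}(R)$. (a) For two $\mathcal{H}_Y$-filters $\mathscr{F}$ and $\mathscr{G}$ on $Y$, $\mathscr{F}=\mathscr{G}$ if and only if $\mathcal{H}_Y^{-1}(\mathscr{F})=\mathcal{H}_Y^{-1}(\mathscr{G})$. (b) If $I$ and $J$ are two strong $\mathcal{H}_Y$-ideals of $R$, then $\mathcal{H}_Y(I)=\mathcal{H}_Y(J)$ if and only if $I=J$. (c) The mapping $I\mapsto\mathcal{H}_Y(I)$ is an order isomorphism from the set of all strong $\mathcal{H}_Y$-ideals of $R$ onto the set of all $\mathcal{H}_Y$-filters on $Y$ (both ordered by inclusion).
   Context: $h_Y(S)=\{P\in Y: S\subseteq P\}$ for $S\subseteq R$, and $h_Y(a)=h_Y(\{a\})$. $\mathcal{H}_Y=\{h_Y(F): F\subseteq R\text{ finite}\}$; it is closed under finite unions and intersections, hence is a bounded distributive lattice under inclusion, with top $Y$ and bottom $\emptyset$. An $\mathcal{H}_Y$-filter on $Y$ is a (nonempty, not necessarily proper) filter of this lattice, i.e. a nonempty subset of $\mathcal{H}_Y$ closed under finite intersections and under supersets belonging to $\mathcal{H}_Y$. For an ideal $I$ of $R$, $\mathcal{H}_Y(I)=\{h_Y(S): S\subseteq I\text{ finite}\}$ (an $\mathcal{H}_Y$-filter), and for an $\mathcal{H}_Y$-filter $\mathscr{F}$, $\mathcal{H}_Y^{-1}(\mathscr{F})=\{a\in R: h_Y(a)\in\mathscr{F}\}$ (an ideal of $R$). An ideal $I$ (not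 necessarily proper) is a strong $\mathcal{H}_Y$-ideal if for every finite $F\subseteq I$ and every $b\in R$, $h_Y(F)\subseteq h_Y(b)$ implies $b\in I$. *)

theory Defs
  imports "HOL-Algebra.Ideal"
begin

definition Spec :: "('a, 'b) ring_scheme \<Rightarrow> 'a set set" where
  "Spec R = {P. primeideal P R}"

definition hset :: "'a set set \<Rightarrow> 'a set \<Rightarrow> 'a set set" where
  "hset Y S = {P \<in> Y. S \<subseteq> P}"

definition hset_lattice :: "('a, 'b) ring_scheme \<Rightarrow> 'a set set \<Rightarrow> 'a set set set" where
  "hset_lattice R Y = {hset Y F | F. finite F \<and> F \<subseteq> carrier R}"

(* Filters need not be proper: the empty set may be a member. *)
definition hset_filter ::
    "('a, 'b) ring_scheme \<Rightarrow> 'a set set \<Rightarrow> 'a set set set \<Rightarrow> bool" where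
  "hset_filter R Y \<F> \<longleftrightarrow>
     \<F> \<subseteq> hset_lattice R Y \<and> \<F> \<noteq> {} \<and>
     (\<forall>A\<in>\<F>. \<forall>B\<in>\<F>. A \<inter> B \<in> \<F>) \<and>
     (\<forall>A\<in>\<F>. \<forall>B\<in>hset_lattice R Y. A \<subseteq> B \<longrightarrow> B \<in> \<F>)"

definition filter_of_ideal :: "'a set set \<Rightarrow> 'a set \<Rightarrow> 'a set set set" where
  "filter_of_ideal Y I = {hset Y S | S. finite S \<and> S \<subseteq> I}"

definition ideal_of_filter ::
    "('a, 'b) ring_scheme \<Rightarrow> 'a set set \<Rightarrow> 'a set set set \<Rightarrow> 'a set" where
  "ideal_of_filter R Y \<F> = {a \<in> carrier R. hset Y {a} \<in> \<F>}"

(* The improper ideal I = carrier R is allowed. *)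
definition strong_hset_ideal ::
    "('a, 'b) ring_scheme \<Rightarrow> 'a set set \<Rightarrow> 'a set \<Rightarrow> bool" where
  "strong_hset_ideal R Y I \<longleftrightarrow>
     ideal I R \<and>
     (\<forall>F b. finite F \<and> F \<subseteq> I \<and> b \<in> carrier R \<and> hset Y F \<subseteq> hset Y {b} \<longrightarrow> b \<in> I)"

end

(* A finite set S satisfies h_Y(S) \<in> F iff h_Y(a) \<in> F for every a \<in> S, because h_Y(S) is the
   intersection of the h_Y(a). Hence the two passages between strong ideals and filters are
   mutually inverse and monotone, and all three parts follow from this. *)
theory Submission
  imports Defs
begin

lemma hset_Un: "hset Y (S \<union> T) = hset Y S \<inter> hset Y T"
  by (auto simp: hset_def)

lemma hset_subset_singleton: "a \<in> S \<Longrightarrow> hset Y S \<subseteq> hset Y {a}"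
  by (auto simp: hset_def)

lemma hset_in_lattice: "finite S \<Longrightarrow> S \<subseteq> carrier R \<Longrightarrow> hset Y S \<in> hset_lattice R Y"
  by (auto simp: hset_lattice_def)

lemma hset_filterD:
  assumes "hset_filter R Y \<F>"
  shows "\<F> \<subseteq> hset_lattice R Y" "\<F> \<noteq> {}"
    and "\<And>A B. A \<in> \<F> \<Longrightarrow> B \<in> \<F> \<Longrightarrow> A \<inter> B \<in> \<F>"
    and "\<And>A B. A \<in> \<F> \<Longrightarrow> B \<in> hset_lattice R Y \<Longrightarrow> A \<subseteq> B \<Longrightarrow> B \<in> \<F>"
  using assms unfolding hset_filter_def by blast+

lemma strong_hset_ideal_subset: "strong_hset_ideal R Y I \<Longrightarrow> I \<subseteq> carrier R"
  by (auto simp: strong_hset_ideal_def dest: ideal.Icarr)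

lemma strong_hset_idealD:
  "\<lbrakk>strong_hset_ideal R Y I; finite F; F \<subseteq> I; b \<in> carrier R; hset Y F \<subseteq> hset Y {b}\<rbrakk> \<Longrightarrow> b \<in> I"
  unfolding strong_hset_ideal_def by blast

text \<open>This turns membership of a basic set in a filter into an inclusion of subsets of the
  ring. Induction on \<open>S\<close> adds one element at a time, each contributing one more set to
  the intersection.\<close>

lemma hset_in_filter_iff:
  assumes "hset_filter R Y \<F>" and "finite S" and "S \<subseteq> carrier R"
  shows "hset Y S \<in> \<F> \<longleftrightarrow> S \<subseteq> ideal_of_filter R Y \<F>"
  using assms(2,3)
proof (induction S rule: finite_induct)
  case empty
  \<comment> \<open>The empty intersection is the top element \<open>hset Y {}\<close>, which is all
    of \<open>Y\<close>. It lies in the filter because some member exists and every lattice member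
    is contained in it.\<close>
  obtain A where A: "A \<in> \<F>" "A \<in> hset_lattice R Y"
    using hset_filterD[OF assms(1)] by blast
  then have "A \<subseteq> hset Y {}"
    by (auto simp: hset_lattice_def hset_def)
  then have "hset Y {} \<in> \<F>"
    using hset_filterD(4)[OF assms(1) A(1)] hset_in_lattice[of "{}" R Y] by simp
  then show ?case by simp
next
  case (insert a S)
  have a: "hset Y {a} \<in> hset_lattice R Y" and S: "hset Y S \<in> hset_lattice R Y"
    using insert by (auto intro!: hset_in_lattice)
  have eq: "hset Y (insert a S) = hset Y {a} \<inter> hset Y S"
    using hset_Un[of Y "{a}" S] by simp
  have "hset Y (insert a S) \<in> \<F> \<longleftrightarrow> hset Y {a} \<in> \<F> \<and> hset Y S \<in> \<F>"
    \<comment> \<open>Upward closure gives both factors from their intersection, and closure under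
      intersections gives the converse.\<close>
    unfolding eq using hset_filterD(3,4)[OF assms(1)] a S by (meson Int_lower1 Int_lower2)
  then show ?case
    using insert by (auto simp: ideal_of_filter_def)
qed

text \<open>Each inclusion is one direction of \<open>hset_in_filter_iff\<close>. For the second, a
  member of the filter is first written as \<open>hset Y S\<close> with \<open>S\<close> finite,
  using that filters live inside the lattice.\<close>

lemma filter_of_ideal_of_filter:
  assumes "hset_filter R Y \<F>"
  shows "filter_of_ideal Y (ideal_of_filter R Y \<F>) = \<F>"
proof
  have "ideal_of_filter R Y \<F> \<subseteq> carrier R"
    by (auto simp: ideal_of_filter_def)
  then show "filter_of_ideal Y (ideal_of_filter R Y \<F>) \<subseteq> \<F>"
    using hset_in_filter_iff[OF assms] unfolding filter_of_ideal_def by blast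
  show "\<F> \<subseteq> filter_of_ideal Y (ideal_of_filter R Y \<F>)"
    using hset_filterD(1)[OF assms] hset_in_filter_iff[OF assms]
    unfolding filter_of_ideal_def hset_lattice_def by blast
qed

text \<open>This is the closure condition of strong ideals, isolated because the ideal axioms
  themselves will be derived from it.\<close>

lemma ideal_of_filter_closed:
  assumes "hset_filter R Y \<F>" and "finite S" and "S \<subseteq> ideal_of_filter R Y \<F>"
    and "b \<in> carrier R" and "hset Y S \<subseteq> hset Y {b}"
  shows "b \<in> ideal_of_filter R Y \<F>"
proof -
  have "S \<subseteq> carrier R"
    using assms(3) by (auto simp: ideal_of_filter_def)
  then have "hset Y S \<in> \<F>"
    using hset_in_filter_iff assms by blast
  then have "hset Y {b} \<in> \<F>"
    using hset_filterD(4)[OF assms(1)] hset_in_lattice[of "{b}"] assms(4,5) by auto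
  then show ?thesis
    using assms(4) by (simp add: ideal_of_filter_def)
qed

text \<open>Every \<open>P\<close> in \<open>Y\<close> is an ideal, so any \<open>P\<close>
  containing given elements contains their sums, negatives and multiples. Each ideal axiom is thus
  an inclusion between basic sets, to which \<open>ideal_of_filter_closed\<close> applies.\<close>

lemma strong_hset_ideal_ideal_of_filter:
  assumes "cring R" and "Y \<subseteq> Spec R" and \<F>: "hset_filter R Y \<F>"
  shows "strong_hset_ideal R Y (ideal_of_filter R Y \<F>)"
proof -
  interpret cring R by fact
  let ?J = "ideal_of_filter R Y \<F>"
  have Y: "ideal P R" if "P \<in> Y" for P
    using assms(2) that by (auto simp: Spec_def primeideal_def)
  have J: "?J \<subseteq> carrier R"
    by (auto simp: ideal_of_filter_def)
  note closed = ideal_of_filter_closed[OF \<F>]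
  note Y_closed = additive_subgroup.zero_closed[OF ideal.axioms(1)[OF Y]]
    additive_subgroup.a_closed[OF ideal.axioms(1)[OF Y]]
    additive_subgroup.a_inv_closed[OF ideal.axioms(1)[OF Y]]
    ideal.I_l_closed[OF Y] ideal.I_r_closed[OF Y]
  have "subgroup ?J (add_monoid R)"
  proof (rule group.subgroupI[OF a_group])
    show "?J \<subseteq> carrier (add_monoid R)" using J by simp
    have "\<zero>\<^bsub>R\<^esub> \<in> ?J"
      \<comment> \<open>The empty generating set suffices, since zero lies in every member of
        \<open>Y\<close>.\<close>
      by (rule closed[of "{}"]) (auto simp: hset_def intro: Y_closed)
    then show "?J \<noteq> {}" by auto
  next
    fix a assume a: "a \<in> ?J"
    then have "\<ominus>\<^bsub>R\<^esub> a \<in> ?J"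
      using J by (intro closed[of "{a}"]) (auto simp: hset_def intro: Y_closed)
    then show "inv\<^bsub>add_monoid R\<^esub> a \<in> ?J" by (simp add: a_inv_def)
  next
    fix a b assume "a \<in> ?J" "b \<in> ?J"
    then have "a \<oplus>\<^bsub>R\<^esub> b \<in> ?J"
      using J by (intro closed[of "{a, b}"]) (auto simp: hset_def intro: Y_closed)
    then show "a \<otimes>\<^bsub>add_monoid R\<^esub> b \<in> ?J" by simp
  qed
  moreover have "x \<otimes>\<^bsub>R\<^esub> a \<in> ?J" "a \<otimes>\<^bsub>R\<^esub> x \<in> ?J" if "a \<in> ?J" "x \<in> carrier R" for a x
    using that J
    by (intro closed[of "{a}"];
        auto simp: hset_def intro: Y_closed)+
  ultimately have "ideal ?J R"
    by (intro idealI) (auto intro: ring_axioms)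
  then show ?thesis
    using closed unfolding strong_hset_ideal_def by blast
qed

text \<open>Intersections come from unions of the finite generating sets; strongness of
  \<open>I\<close> enters in the upward closure.\<close>

lemma hset_filter_filter_of_ideal:
  assumes "strong_hset_ideal R Y I"
  shows "hset_filter R Y (filter_of_ideal Y I)"
  unfolding hset_filter_def
proof (intro conjI ballI impI)
  show "filter_of_ideal Y I \<subseteq> hset_lattice R Y"
    using strong_hset_ideal_subset[OF assms] unfolding filter_of_ideal_def hset_lattice_def by blast
  show "filter_of_ideal Y I \<noteq> {}"
    by (auto simp: filter_of_ideal_def)
next
  fix A B assume "A \<in> filter_of_ideal Y I" "B \<in> filter_of_ideal Y I"
  then obtain S T where "finite S" "S \<subseteq> I" "A = hset Y S" "finite T" "T \<subseteq> I" "B = hset Y T"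
    by (auto simp: filter_of_ideal_def)
  then show "A \<inter> B \<in> filter_of_ideal Y I"
    unfolding filter_of_ideal_def by (auto intro!: exI[of _ "S \<union> T"] simp: hset_Un)
next
  fix A B assume "A \<in> filter_of_ideal Y I" "B \<in> hset_lattice R Y" and AB: "A \<subseteq> B"
  then obtain S T where S: "finite S" "S \<subseteq> I" "A = hset Y S"
    and T: "finite T" "T \<subseteq> carrier R" "B = hset Y T"
    by (auto simp: filter_of_ideal_def hset_lattice_def)
  \<comment> \<open>The set \<open>T\<close> presenting \<open>B\<close> is a priori only a subset
    of the carrier. From \<open>hset Y S \<subseteq> hset Y T \<subseteq> hset Y {t}\<close>,
    strongness pulls each \<open>t\<close> into \<open>I\<close>, so \<open>T\<close> itself
    witnesses membership of \<open>B\<close>.\<close>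
  have "t \<in> I" if "t \<in> T" for t
    using strong_hset_idealD[OF assms S(1,2)] hset_subset_singleton[OF that] AB S T that by blast
  then show "B \<in> filter_of_ideal Y I"
    using T by (auto simp: filter_of_ideal_def)
qed

text \<open>If \<open>hset Y {a}\<close> equals \<open>hset Y S\<close> for some finite
  \<open>S \<subseteq> I\<close>, strongness forces \<open>a \<in> I\<close>. Conversely, an element
  of \<open>I\<close> is witnessed by its own singleton.\<close>

lemma ideal_of_filter_of_ideal:
  assumes "strong_hset_ideal R Y I"
  shows "ideal_of_filter R Y (filter_of_ideal Y I) = I"
proof
  show "ideal_of_filter R Y (filter_of_ideal Y I) \<subseteq> I"
  proof
    fix a assume "a \<in> ideal_of_filter R Y (filter_of_ideal Y I)"
    then obtain S where "a \<in> carrier R" "finite S" "S \<subseteq> I" "hset Y {a} = hset Y S"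
      by (auto simp: ideal_of_filter_def filter_of_ideal_def)
    then show "a \<in> I"
      using strong_hset_idealD[OF assms] by blast
  qed
  show "I \<subseteq> ideal_of_filter R Y (filter_of_ideal Y I)"
    using strong_hset_ideal_subset[OF assms]
    by (auto simp: ideal_of_filter_def filter_of_ideal_def intro!: exI[of _ "{_}"])
qed

lemma filter_of_ideal_mono: "I \<subseteq> J \<Longrightarrow> filter_of_ideal Y I \<subseteq> filter_of_ideal Y J"
  unfolding filter_of_ideal_def by blast

lemma ideal_of_filter_mono: "\<F> \<subseteq> \<G> \<Longrightarrow> ideal_of_filter R Y \<F> \<subseteq> ideal_of_filter R Y \<G>"
  unfolding ideal_of_filter_def by blast

theorem corollary4p2:
  fixes R :: "('a, 'b) ring_scheme" and Y :: "'a set set"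
  assumes "cring R" and "Y \<subseteq> Spec R"
  shows
    "(\<forall>\<F> \<G>. hset_filter R Y \<F> \<and> hset_filter R Y \<G> \<longrightarrow>
        (\<F> = \<G> \<longleftrightarrow> ideal_of_filter R Y \<F> = ideal_of_filter R Y \<G>)) \<and>
     (\<forall>I J. strong_hset_ideal R Y I \<and> strong_hset_ideal R Y J \<longrightarrow>
        (filter_of_ideal Y I = filter_of_ideal Y J \<longleftrightarrow> I = J)) \<and>
     (bij_betw (filter_of_ideal Y) {I. strong_hset_ideal R Y I} {\<F>. hset_filter R Y \<F>} \<and>
      (\<forall>I J. strong_hset_ideal R Y I \<and> strong_hset_ideal R Y J \<longrightarrow>
        (I \<subseteq> J \<longleftrightarrow> filter_of_ideal Y I \<subseteq> filter_of_ideal Y J)))"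
proof (intro conjI allI impI)
  fix \<F> \<G> assume "hset_filter R Y \<F> \<and> hset_filter R Y \<G>"
  then show "\<F> = \<G> \<longleftrightarrow> ideal_of_filter R Y \<F> = ideal_of_filter R Y \<G>"
    by (metis filter_of_ideal_of_filter)
next
  fix I J assume "strong_hset_ideal R Y I \<and> strong_hset_ideal R Y J"
  then show "filter_of_ideal Y I = filter_of_ideal Y J \<longleftrightarrow> I = J"
    by (metis ideal_of_filter_of_ideal)
next
  show "bij_betw (filter_of_ideal Y) {I. strong_hset_ideal R Y I} {\<F>. hset_filter R Y \<F>}"
    by (rule bij_betw_byWitness[where f' = "ideal_of_filter R Y"])
      (auto simp: ideal_of_filter_of_ideal filter_of_ideal_of_filter
        hset_filter_filter_of_ideal strong_hset_ideal_ideal_of_filter[OF assms])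
next
  fix I J assume "strong_hset_ideal R Y I \<and> strong_hset_ideal R Y J"
  then show "I \<subseteq> J \<longleftrightarrow> filter_of_ideal Y I \<subseteq> filter_of_ideal Y J"
    \<comment> \<open>Order is reflected because applying the monotone map
      \<open>ideal_of_filter R Y\<close> to both filters recovers \<open>I\<close> and
      \<open>J\<close>.\<close>
    by (metis ideal_of_filter_of_ideal filter_of_ideal_mono ideal_of_filter_mono)
qed

end
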